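(* There exists an oracle $D$ such that (the set $D$, which lies in $\mathrm{P}^D$) $D$ is not $D$-scalable and $\mathrm{census}_D\notin\mathrm{FP}^D$.
   Context: Strings are over $\Sigma=\{0,1\}$, with $\le$ the standard lexicographic order. $\mathrm{census}_D(1^n)=|\{x\in D:|x|=n\}|$. A set is rankable in $\mathrm{FP}^X$ if its ranking function $x\mapsto|\{y\le x:y\in$ set$\}|$ is computable by a deterministic polynomial-time oracle transducer with oracle $X$. A $\mathrm{P}^X$-isomorphism is a bijection $\phi:\Sigma^*\to\Sigma^*$ with $\phi,\phi^{-1}\in\mathrm{FP}^X$. A set is $X$-scalable if there is a $\mathrm{P}^X$-isomorphism mapping it onto some set rankable in $\mathrm{FP}^X$. *)

theory Defs
  imports Complex_Main "HOL-Library.List_Lenlexorder" "HOL-Computational_Algebra.Polynomial"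
begin

text \<open>
  Strings over \<open>{0,1}\<close> are Boolean lists, with \<open>True\<close> for 1. The order on them is the one of
  \<open>List_Lenlexorder\<close>: shorter strings first, strings of equal length lexicographically, i.e.
  the standard enumeration of all strings (so that every string has finitely many predecessors).
\<close>

type_synonym str = "bool list"

text \<open>
  Deterministic multi-tape oracle Turing machines. Tapes are infinite to the right; tape 0 holds the
  input, tape 1 the output, tape 2 the query, and further tapes are work tapes. States and auxiliary
  symbols are numbers; the transition function is a partial function with finite domain, so a
  machine involves only finitely many states and symbols. A machine halts where its transition
  function is undefined. In the query state it asks whether the string on the query tape is in the
  oracle and moves to the yes- or no-state, with the query tape erased, in one step.
\<close>

datatype sym = Blank | Bit bool | Aux nat

datatype dir = Go_Left | Stay | Go_Right

type_synonym tape = "(nat \<Rightarrow> sym) \<times> nat"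

record otm =
  work_tapes :: nat
  start_state :: nat
  query_state :: nat
  yes_state :: nat
  no_state :: nat
  accept_state :: nat
  delta :: "nat \<times> sym list \<rightharpoonup> nat \<times> (sym \<times> dir) list"

definition wf_otm :: "otm \<Rightarrow> bool" where
  "wf_otm M \<longleftrightarrow> finite (dom (delta M)) \<and>
     (\<forall>(q, acts) \<in> ran (delta M). length acts = 3 + work_tapes M)"

type_synonym config = "nat \<times> tape list"

definition blank_tape :: tape where
  "blank_tape = (\<lambda>_. Blank, 0)"

definition input_tape :: "str \<Rightarrow> tape" where
  "input_tape x = (\<lambda>i. if i < length x then Bit (x ! i) else Blank, 0)"

definition init_config :: "otm \<Rightarrow> str \<Rightarrow> config" where
  "init_config M x = (start_state M, input_tape x # replicate (2 + work_tapes M) blank_tape)"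

definition read_sym :: "tape \<Rightarrow> sym" where
  "read_sym = (\<lambda>(f, h). f h)"

fun move_head :: "dir \<Rightarrow> nat \<Rightarrow> nat" where
  "move_head Go_Left h = h - 1"
| "move_head Stay h = h"
| "move_head Go_Right h = Suc h"

definition act :: "sym \<times> dir \<Rightarrow> tape \<Rightarrow> tape" where
  "act = (\<lambda>(s, d) (f, h). (f(h := s), move_head d h))"

text \<open>The string on a tape is its longest initial segment of cells containing bits.\<close>

definition tape_str :: "tape \<Rightarrow> str" where
  "tape_str = (\<lambda>(f, h). map (\<lambda>i. f i = Bit True) [0..<(LEAST i. f i \<notin> range Bit)])"

definition step :: "otm \<Rightarrow> str set \<Rightarrow> config \<Rightarrow> config option" where
  "step M X = (\<lambda>(q, ts).
     if q = query_state M
     then Some (if tape_str (ts ! 2) \<in> X then yes_state M else no_state M, ts[2 := blank_tape])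
     else (case delta M (q, map read_sym ts) of
             None \<Rightarrow> None
           | Some (q', acts) \<Rightarrow> Some (q', map2 act acts ts)))"

definition halts_in :: "otm \<Rightarrow> str set \<Rightarrow> str \<Rightarrow> nat \<Rightarrow> config \<Rightarrow> bool" where
  "halts_in M X x t c \<longleftrightarrow>
     ((\<lambda>c c'. step M X c = Some c') ^^ t) (init_config M x) c \<and> step M X c = None"

text \<open>
  The parameter \<open>S\<close> is the domain of the function: only inputs from \<open>S\<close> are considered.
\<close>

definition FP_on :: "str set \<Rightarrow> str set \<Rightarrow> (str \<Rightarrow> str) set" where
  "FP_on S X = {f. \<exists>M (p :: nat poly). wf_otm M \<and>
     (\<forall>x\<in>S. \<exists>t \<le> poly p (length x). \<exists>q ts. halts_in M X x t (q, ts) \<and> tape_str (ts ! 1) = f x)}"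

abbreviation FP :: "str set \<Rightarrow> (str \<Rightarrow> str) set" where
  "FP X \<equiv> FP_on UNIV X"

definition PTIME :: "str set \<Rightarrow> str set set" where
  "PTIME X = {A. \<exists>M (p :: nat poly). wf_otm M \<and>
     (\<forall>x. \<exists>t \<le> poly p (length x). \<exists>q ts. halts_in M X x t (q, ts) \<and>
        (q = accept_state M \<longleftrightarrow> x \<in> A))}"

text \<open>Binary notation without leading zeros, most significant bit first.\<close>

fun bin :: "nat \<Rightarrow> str" where
  "bin n = (if n < 2 then [n = 1] else bin (n div 2) @ [odd n])"

declare bin.simps [simp del]

definition rank_fun :: "str set \<Rightarrow> str \<Rightarrow> nat" where
  "rank_fun A x = card {y \<in> A. y \<le> x}"

definition rankable :: "str set \<Rightarrow> str set \<Rightarrow> bool" where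
  "rankable X A \<longleftrightarrow> (\<lambda>x. bin (rank_fun A x)) \<in> FP X"

definition P_isomorphism :: "str set \<Rightarrow> (str \<Rightarrow> str) \<Rightarrow> bool" where
  "P_isomorphism X \<phi> \<longleftrightarrow> bij \<phi> \<and> \<phi> \<in> FP X \<and> inv \<phi> \<in> FP X"

definition scalable :: "str set \<Rightarrow> str set \<Rightarrow> bool" where
  "scalable X A \<longleftrightarrow> (\<exists>\<phi>. P_isomorphism X \<phi> \<and> rankable X (\<phi> ` A))"

text \<open>The census function takes its argument in unary; it is of interest on \<open>unary\<close> only.\<close>

definition unary :: "str set" where
  "unary = {replicate n True | n. True}"

definition census :: "str set \<Rightarrow> str \<Rightarrow> nat" where
  "census A x = card {y \<in> A. length y = length x}"

end

theory Submission
  imports Defs "HOL-Library.Countable_Set" "HOL-Real_Asymp.Real_Asymp"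
begin

text \<open>
  Build \<open>D\<close> by finite extension, adding at most one string for each requirement and then leaving a
  gap in the lengths that exceeds the polynomials of that requirement. A machine running in time
  less than \<open>2^n\<close> leaves some string of length \<open>n\<close> unqueried, and deciding its membership afterwards
  makes the machine miscount \<open>D\<close>; this refutes computability of the census. Ranking an isomorphic
  copy amounts to counting as well: if \<open>q\<close> bounds the running times of \<open>\<phi>\<close> and its inverse and \<open>D\<close>
  has no string of length in \<open>(n, q (q n)]\<close>, then the rank of \<open>1^(q n)\<close> in \<open>\<phi> ` D\<close> is the number of
  strings in \<open>D\<close> of length at most \<open>n\<close>, whatever \<open>\<phi>\<close> is.
\<close>

section \<open>Growth and coding\<close>

lemma poly_nat_mono: "m \<le> n \<Longrightarrow> poly (p :: nat poly) m \<le> poly p n"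
  by (induction p) (auto intro: add_mono mult_mono)

lemma poly_nat_le: "n \<ge> 1 \<Longrightarrow> poly (p :: nat poly) n \<le> (\<Sum>i\<le>degree p. coeff p i) * n ^ degree p"
  unfolding poly_altdef sum_distrib_right
  by (intro sum_mono mult_mono power_increasing) auto

text \<open>The exponential outgrows the monomial bound of \<open>poly_nat_le\<close>. Having such
  an \<open>n\<close> beyond any \<open>N\<close> lets each requirement act on lengths that are
  still undecided.\<close>

lemma poly_nat_less_power2: "\<exists>n>N. poly (p :: nat poly) n < 2 ^ n"
proof -
  define c k where "c = real (\<Sum>i\<le>degree p. coeff p i)" and "k = degree p"
  have "((\<lambda>n::nat. c * real n ^ k / 2 ^ n) \<longlongrightarrow> 0) at_top"
    by real_asymp
  then have "eventually (\<lambda>n::nat. c * real n ^ k / 2 ^ n < 1) at_top"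
    by (rule order_tendstoD) simp
  then have "eventually (\<lambda>n::nat. c * real n ^ k / 2 ^ n < 1 \<and> n > N) at_top"
    using eventually_gt_at_top by (rule eventually_conj)
  then obtain n where n: "c * real n ^ k / 2 ^ n < 1" "n > N"
    by (metis (no_types, lifting) eventually_happens' sequentially_bot)
  then have "real ((\<Sum>i\<le>degree p. coeff p i) * n ^ degree p) < real (2 ^ n)"
    by (simp add: c_def k_def field_simps)
  then have "(\<Sum>i\<le>degree p. coeff p i) * n ^ degree p < 2 ^ n"
    by (simp only: of_nat_less_iff)
  then show ?thesis
    using poly_nat_le[of n p] n by (intro exI[of _ n]) auto
qed

lemma bin_nonempty: "bin n \<noteq> []"
  by (subst bin.simps) simp

lemma bin_inject: "bin m = bin n \<longleftrightarrow> m = n"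
proof (induction m arbitrary: n rule: less_induct)
  case (less m)
  show ?case
  proof
    assume eq: "bin m = bin n"
    show "m = n"
    proof (cases "m < 2 \<or> n < 2")
      case True
      then show ?thesis
        \<comment> \<open>Nonemptiness separates one-digit numerals from longer ones.\<close>
        using eq bin_nonempty[of "m div 2"] bin_nonempty[of "n div 2"]
        by (subst (asm) (1 2) bin.simps) (auto split: if_splits)
    next
      case False
      then have "bin (m div 2) = bin (n div 2)" "odd m = odd n"
        using eq by (simp_all add: bin.simps[of m] bin.simps[of n])
      then have "m div 2 = n div 2" "m mod 2 = n mod 2"
        using less.IH[of "m div 2"] False by (auto simp: parity_cases odd_iff_mod_2_eq_one)
      then show ?thesis by (metis div_mult_mod_eq)
    qed
  qed simp
qed

text \<open>The all-ones string is the last of its length, so a rank taken there counts every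
  element up to that length.\<close>

lemma le_replicate_True_iff: "y \<le> replicate m True \<longleftrightarrow> length y \<le> m"
proof (induction y arbitrary: m)
  case (Cons b y)
  show ?case
  proof (cases m)
    case (Suc k)
    then show ?thesis using Cons.IH[of k] by (cases b) (auto simp: Cons_le_Cons)
  qed simp
qed simp

section \<open>Runs of oracle machines\<close>

text \<open>A functional form of the run, equal to \<open>None\<close> from the step after halting
  on; it allows runs under two oracles to be compared by an equation.\<close>

primrec conf :: "otm \<Rightarrow> str set \<Rightarrow> str \<Rightarrow> nat \<Rightarrow> config option" where
  "conf M X x 0 = Some (init_config M x)"
| "conf M X x (Suc t) = Option.bind (conf M X x t) (step M X)"

lemma relpowp_step_iff_conf:
  "((\<lambda>c c'. step M X c = Some c') ^^ t) (init_config M x) c \<longleftrightarrow> conf M X x t = Some c"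
  by (induction t arbitrary: c) (auto simp: bind_eq_Some_conv OO_def)

lemma halts_in_iff_conf:
  "halts_in M X x t c \<longleftrightarrow> conf M X x t = Some c \<and> step M X c = None"
  unfolding halts_in_def relpowp_step_iff_conf ..

lemma halts_in_unique:
  assumes "halts_in M X x t c" "halts_in M X x t' c'"
  shows "c = c'"
proof -
  have conf_after: "conf M X x (Suc t + d) = None" if "halts_in M X x t c" for t c d
    using that by (induction d) (auto simp: halts_in_iff_conf)
  have "t = t'"
  proof (rule linorder_cases[of t t'])
    assume "t < t'"
    then show ?thesis
      using conf_after[OF assms(1), of "t' - Suc t"] assms(2) by (simp add: halts_in_iff_conf)
  next
    assume "t' < t"
    then show ?thesis
      using conf_after[OF assms(2), of "t - Suc t'"] assms(1) by (simp add: halts_in_iff_conf)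
  qed
  then show ?thesis using assms by (simp add: halts_in_iff_conf)
qed

definition computes_within :: "otm \<Rightarrow> str set \<Rightarrow> str \<Rightarrow> nat \<Rightarrow> str \<Rightarrow> bool" where
  "computes_within M X x T y \<longleftrightarrow>
     (\<exists>t\<le>T. \<exists>q ts. halts_in M X x t (q, ts) \<and> tape_str (ts ! 1) = y)"

lemma computes_within_unique:
  "computes_within M X x T y \<Longrightarrow> computes_within M X x T' y' \<Longrightarrow> y = y'"
  unfolding computes_within_def by (auto dest: halts_in_unique)

lemma mem_FP_on_iff:
  "f \<in> FP_on S X \<longleftrightarrow>
     (\<exists>M p. wf_otm M \<and> (\<forall>x\<in>S. computes_within M X x (poly p (length x)) (f x)))"
  unfolding FP_on_def computes_within_def by blast

section \<open>Bounds on the lengths of outputs and queries\<close>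

definition short_tape :: "nat \<Rightarrow> tape \<Rightarrow> bool" where
  "short_tape t = (\<lambda>(f, h). h \<le> t \<and> (\<forall>j\<ge>t. f j = Blank))"

lemma short_tape_blank: "short_tape t blank_tape"
  by (simp add: short_tape_def blank_tape_def)

lemma short_tape_Suc: "short_tape t T \<Longrightarrow> short_tape (Suc t) T"
  by (auto simp: short_tape_def)

lemma short_tape_act: "short_tape t T \<Longrightarrow> short_tape (Suc t) (act a T)"
  by (cases a; cases "snd a") (auto simp: short_tape_def act_def split: prod.splits)

lemma length_tape_str_le:
  assumes "short_tape t T"
  shows "length (tape_str T) \<le> t"
proof -
  obtain f h where T: "T = (f, h)" by force
  then have "f t \<notin> range Bit" using assms by (auto simp: short_tape_def)
  then show ?thesis unfolding T tape_str_def by (auto intro: Least_le)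
qed

text \<open>A head advances at most one cell per step, so a tape that starts blank gains at most one
  cell per step; the input tape does not start blank and is left out. The number of tapes is part of
  the invariant because \<open>map2\<close> truncates to the shorter list.\<close>

lemma conf_short_tapes:
  assumes "wf_otm M" "conf M X x t = Some (q, ts)"
  shows "length ts = 3 + work_tapes M \<and> short_tape t (ts ! 1) \<and> short_tape t (ts ! 2)"
  using assms(2)
proof (induction t arbitrary: q ts)
  case 0
  then show ?case by (auto simp: init_config_def short_tape_blank numeral_2_eq_2)
next
  case (Suc t)
  then obtain q' ts' where c: "conf M X x t = Some (q', ts')" "step M X (q', ts') = Some (q, ts)"
    by (auto simp: bind_eq_Some_conv)
  note IH = Suc.IH[OF c(1)]
  show ?case
  proof (cases "q' = query_state M")
    case True
    then show ?thesis using c(2) IH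
      by (auto simp: step_def nth_list_update short_tape_blank short_tape_Suc)
  next
    case False
    then obtain acts where acts: "delta M (q', map read_sym ts') = Some (q, acts)"
        "ts = map2 act acts ts'"
      using c(2) by (auto simp: step_def split: option.splits)
    then have "length acts = 3 + work_tapes M"
      using assms(1) unfolding wf_otm_def by (auto simp: ran_def)
    then show ?thesis using acts(2) IH by (auto simp: short_tape_act)
  qed
qed

lemma computes_within_length_le:
  assumes "wf_otm M" "computes_within M X x T y"
  shows "length y \<le> T"
proof -
  obtain t q ts where "t \<le> T" "conf M X x t = Some (q, ts)" "tape_str (ts ! 1) = y"
    using assms(2) unfolding computes_within_def halts_in_iff_conf by blast
  then show ?thesis
    using conf_short_tapes[OF assms(1), of X x t q ts] length_tape_str_le[of t "ts ! 1"] by simp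
qed

section \<open>Dependence of a run on the oracle\<close>

definition queried :: "otm \<Rightarrow> str set \<Rightarrow> str \<Rightarrow> nat \<Rightarrow> str set" where
  "queried M X x T = {tape_str (ts ! 2) | t ts. t < T \<and> conf M X x t = Some (query_state M, ts)}"

lemma queried_subset_image:
  "queried M X x T \<subseteq> (\<lambda>t. tape_str (snd (the (conf M X x t)) ! 2)) ` {..<T}"
  by (force simp: queried_def)

lemma card_queried_le: "card (queried M X x T) \<le> T"
  using surj_card_le[OF _ queried_subset_image] by simp

lemma finite_queried: "finite (queried M X x T)"
  using queried_subset_image by (rule finite_subset) simp

lemma length_queried_le:
  assumes "wf_otm M" "w \<in> queried M X x T"
  shows "length w \<le> T"
proof -
  obtain t ts where "t < T" "conf M X x t = Some (query_state M, ts)" "w = tape_str (ts ! 2)"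
    using assms(2) unfolding queried_def by blast
  then show ?thesis
    using conf_short_tapes[OF assms(1), of X x t _ ts] length_tape_str_le[of t "ts ! 2"] by simp
qed

text \<open>Agreement on the queries of the run under \<open>X\<close> is enough: as long as the
  answers coincide, the run under \<open>Y\<close> asks the same questions.\<close>

lemma conf_cong_oracle:
  assumes "\<And>w. w \<in> queried M X x T \<Longrightarrow> w \<in> X \<longleftrightarrow> w \<in> Y" "t \<le> T"
  shows "conf M X x t = conf M Y x t"
  using assms(2)
proof (induction t)
  case (Suc t)
  have "step M X c = step M Y c" if c: "conf M X x t = Some c" for c
  proof (cases c)
    case (Pair q ts)
    have "tape_str (ts ! 2) \<in> queried M X x T" if "q = query_state M"
      using c Suc.prems that Pair unfolding queried_def by (auto simp: Suc_le_eq)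
    then show ?thesis
      using assms(1)[of "tape_str (ts ! 2)"] Pair by (auto simp: step_def)
  qed
  moreover have "conf M X x t = conf M Y x t" using Suc by simp
  ultimately show ?case by (cases "conf M X x t") (auto dest: sym)
qed simp

lemma computes_within_cong_oracle:
  assumes "\<And>w. w \<in> queried M X x T \<Longrightarrow> w \<in> X \<longleftrightarrow> w \<in> Y"
  shows "computes_within M X x T y \<longleftrightarrow> computes_within M Y x T y"
proof -
  \<comment> \<open>A query always has a successor, so halting never depends on the oracle. Hence
    queries at times strictly below \<open>T\<close> decide the whole outcome.\<close>
  have "step M X c = None \<longleftrightarrow> step M Y c = None" for c
    by (auto simp: step_def split: prod.splits option.splits)
  then have "halts_in M X x t c \<longleftrightarrow> halts_in M Y x t c" if "t \<le> T" for t c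
    unfolding halts_in_iff_conf using conf_cong_oracle[of M X x T Y t] assms that by simp
  then show ?thesis unfolding computes_within_def by blast
qed

section \<open>Forcing\<close>

definition agree_upto :: "nat \<Rightarrow> str set \<Rightarrow> str set \<Rightarrow> bool" where
  "agree_upto N A B \<longleftrightarrow> (\<forall>x. length x \<le> N \<longrightarrow> (x \<in> A \<longleftrightarrow> x \<in> B))"

lemma agree_upto_trans: "agree_upto N A B \<Longrightarrow> agree_upto N' B C \<Longrightarrow> N \<le> N' \<Longrightarrow> agree_upto N A C"
  by (auto simp: agree_upto_def)

text \<open>The sets agreeing with \<open>A\<close> up to length \<open>N\<close> form a basic open
  set of Cantor space; \<open>forceable P\<close> says that the interior of \<open>P\<close> is
  dense.\<close>

definition forceable :: "(str set \<Rightarrow> bool) \<Rightarrow> bool" where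
  "forceable P \<longleftrightarrow>
     (\<forall>A N. \<exists>A' N'. N \<le> N' \<and> agree_upto N A A' \<and> (\<forall>D. agree_upto N' A' D \<longrightarrow> P D))"

text \<open>This is the Baire category theorem for Cantor space: the requirements are met one after
  another along a shrinking sequence of basic open sets, and the limit satisfies them all.\<close>

lemma exists_generic:
  assumes "countable \<P>" "\<And>P. P \<in> \<P> \<Longrightarrow> forceable P"
  shows "\<exists>D. \<forall>P\<in>\<P>. P D"
proof (cases "\<P> = {}")
  case False
  define P where "P = from_nat_into \<P>"
  have forceable: "forceable (P i)" for i
    using assms(2) from_nat_into[OF False] by (simp add: P_def)
  define R where "R i c c' \<longleftrightarrow> snd c < snd c' \<and> agree_upto (snd c) (fst c) (fst c') \<and>
      (\<forall>D. agree_upto (snd c') (fst c') D \<longrightarrow> P i D)" for i and c c' :: "str set \<times> nat"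
  have "\<exists>c'. R i c c'" for i c
  proof -
    obtain A' N' where "snd c \<le> N'" "agree_upto (snd c) (fst c) A'"
        "\<forall>D. agree_upto N' A' D \<longrightarrow> P i D"
      using forceable[of i] unfolding forceable_def by blast
    \<comment> \<open>Forcing yields only a weakly larger bound; the successor makes the bounds
      strictly increasing, so that every length is eventually decided.\<close>
    then have "R i c (A', Suc N')"
      by (auto simp: R_def agree_upto_def)
    then show ?thesis ..
  qed
  then obtain c where c: "\<And>i. R i (c i) (c (Suc i))"
    using dependent_nat_choice[of "\<lambda>_ _. True" R] by auto
  define A N where "A i = fst (c i)" and "N i = snd (c i)" for i
  have N: "N i < N (Suc i)" and step: "agree_upto (N i) (A i) (A (Suc i))"
    and P: "\<And>D. agree_upto (N (Suc i)) (A (Suc i)) D \<Longrightarrow> P i D" for i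
    using c[of i] by (auto simp: R_def A_def N_def)
  have mono: "strict_mono N" using N by (simp add: strict_mono_Suc_iff)
  have agree: "agree_upto (N i) (A i) (A j)" if "i \<le> j" for i j
    using that
  proof (induction rule: dec_induct)
    case (step j)
    then show ?case
      using \<open>agree_upto (N j) (A j) (A (Suc j))\<close> strict_mono_less_eq[OF mono]
      by (blast intro: agree_upto_trans)
  qed (simp add: agree_upto_def)
  \<comment> \<open>Strict growth gives \<open>length x \<le> N (length x)\<close>, so stage
    \<open>length x\<close> has already settled the membership of \<open>x\<close>.\<close>
  define D where "D = {x. x \<in> A (length x)}"
  have "agree_upto (N i) (A i) D" for i
    unfolding agree_upto_def
  proof (intro allI impI)
    fix x :: str assume "length x \<le> N i"
    moreover have "length x \<le> N (length x)"
      using mono by (rule strict_mono_imp_increasing)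
    ultimately have "x \<in> A i \<longleftrightarrow> x \<in> A (length x)"
      using agree[of i "length x"] agree[of "length x" i] unfolding agree_upto_def
      by (meson nat_le_linear)
    then show "x \<in> A i \<longleftrightarrow> x \<in> D" by (simp add: D_def)
  qed
  then have "P i D" for i by (rule P)
  then show ?thesis
    using from_nat_into_surj[OF assms(1)] unfolding P_def by force
qed simp

section \<open>Diagonalization against counting machines\<close>

lemma card_strings_of_length: "card {w :: str. length w = n} = 2 ^ n"
  using card_lists_length_eq[of "UNIV :: bool set" n] by simp

lemma finite_strings_upto: "finite {w :: str. length w \<le> n}"
  using finite_lists_length_le[of "UNIV :: bool set" n] by simp

text \<open>Fewer than \<open>2 ^ n\<close> queries miss some \<open>w\<close> of length
  \<open>n\<close>. The outputs for \<open>B\<close> and \<open>insert w B\<close> then coincide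
  while the counts differ, so one of the two sets is miscounted. Queries have length at most
  \<open>T\<close>, so the error persists in every \<open>D\<close> that agrees with this set up to
  \<open>T\<close>.\<close>

lemma exists_miscounted:
  fixes count :: "str set \<Rightarrow> nat"
  assumes "wf_otm M" "T < 2 ^ n"
    and count: "\<And>w. length w = n \<Longrightarrow> count (insert w B) \<noteq> count B"
  shows "\<exists>A. B \<subseteq> A \<and> (\<forall>w\<in>A - B. length w = n) \<and>
    (\<forall>D. agree_upto T A D \<longrightarrow> \<not> computes_within M D x T (bin (count A)))"
proof -
  have "card (queried M B x T) < card {w :: str. length w = n}"
    using assms(2) card_queried_le[of M B x T] by (simp add: card_strings_of_length)
  then have "\<not> {w :: str. length w = n} \<subseteq> queried M B x T"
    using card_mono[OF finite_queried] by (metis not_le)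
  then obtain w where w: "length w = n" "w \<notin> queried M B x T" by auto
  have "computes_within M B x T y \<longleftrightarrow> computes_within M (insert w B) x T y" for y
    using w by (intro computes_within_cong_oracle) auto
  then have "\<exists>A\<in>{B, insert w B}. \<not> computes_within M A x T (bin (count A))"
    using computes_within_unique count[OF w(1)] by (metis bin_inject insertCI)
  then obtain A where A: "A \<in> {B, insert w B}" "\<not> computes_within M A x T (bin (count A))"
    by blast
  have "\<not> computes_within M D x T (bin (count A))" if "agree_upto T A D" for D
    using A(2) that computes_within_cong_oracle[of M A x T D] length_queried_le[OF assms(1)]
    unfolding agree_upto_def by blast
  then show ?thesis using A(1) w(1) by (intro exI[of _ A]) auto
qed

lemma forceable_census:
  assumes "wf_otm M"
  shows "forceable (\<lambda>D. \<exists>x\<in>unary. \<not> computes_within M D x (poly p (length x)) (bin (census D x)))"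
  unfolding forceable_def
proof (intro allI)
  fix A N
  obtain n where n: "n > N" "poly p n < 2 ^ n" using poly_nat_less_power2 by blast
  \<comment> \<open>Truncation respects what is already decided and empties level \<open>n\<close>,
    so one added string changes the census from 0 to 1.\<close>
  define B :: "str set" where "B = {w \<in> A. length w \<le> N}"
  define x where "x = replicate n True"
  have count: "census (insert w B) x \<noteq> census B x" if "length w = n" for w
  proof -
    have "{y \<in> insert w B. length y = length x} = {w}" "{y \<in> B. length y = length x} = {}"
      using that n by (auto simp: x_def B_def)
    then show ?thesis unfolding census_def by (simp only:) simp
  qed
  obtain A' where A': "B \<subseteq> A'" "\<forall>w\<in>A' - B. length w = n"
      "\<forall>D. agree_upto (poly p n) A' D \<longrightarrow> \<not> computes_within M D x (poly p n) (bin (census A' x))"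
    using exists_miscounted[where count = "\<lambda>X. census X x", OF assms n(2) count] by blast
  show "\<exists>A' N'. N \<le> N' \<and> agree_upto N A A' \<and> (\<forall>D. agree_upto N' A' D \<longrightarrow>
      (\<exists>x\<in>unary. \<not> computes_within M D x (poly p (length x)) (bin (census D x))))"
  \<comment> \<open>The summand \<open>n\<close> fixes the census at \<open>x\<close>, and
    \<open>poly p n\<close> fixes the run of the machine.\<close>
  proof (intro exI[of _ A'] exI[of _ "n + poly p n"] conjI allI impI)
    show "N \<le> n + poly p n" using n by simp
    show "agree_upto N A A'"
      unfolding agree_upto_def
    proof (intro allI impI)
      fix w :: str assume w: "length w \<le> N"
      then have "w \<in> A \<longleftrightarrow> w \<in> B" by (simp add: B_def)
      moreover have "w \<notin> A' - B" using bspec[OF A'(2), of w] w n(1) by auto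
      ultimately show "w \<in> A \<longleftrightarrow> w \<in> A'" using A'(1) by blast
    qed
    fix D assume D: "agree_upto (n + poly p n) A' D"
    then have "census D x = census A' x"
      unfolding census_def agree_upto_def x_def by (intro arg_cong[of _ _ card]) auto
    moreover have "agree_upto (poly p n) A' D" using D by (simp add: agree_upto_def)
    ultimately have "\<not> computes_within M D x (poly p (length x)) (bin (census D x))"
      using A'(3) by (simp add: x_def)
    then show "\<exists>x\<in>unary. \<not> computes_within M D x (poly p (length x)) (bin (census D x))"
      by (rule bexI) (auto simp: unary_def x_def)
  qed
qed

text \<open>\<open>M\<close> is a purported ranking machine with time bound \<open>p\<close>, and
  \<open>q\<close> bounds lengths under an isomorphism and its inverse. The isomorphism itself does
  not occur, so the requirement only has to defeat \<open>M\<close>.\<close>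

definition miscounts_below_gap :: "otm \<Rightarrow> nat poly \<Rightarrow> nat poly \<Rightarrow> str set \<Rightarrow> bool" where
  "miscounts_below_gap M p q D \<longleftrightarrow> (\<exists>n. (\<forall>x\<in>D. length x \<le> n \<or> poly q (poly q n) < length x) \<and>
     \<not> computes_within M D (replicate (poly q n) True) (poly p (poly q n))
         (bin (card {x \<in> D. length x \<le> n})))"

lemma forceable_miscounts_below_gap:
  assumes "wf_otm M"
  shows "forceable (miscounts_below_gap M p q)"
  unfolding forceable_def
proof (intro allI)
  fix A N
  obtain n where n: "n > N" "poly p (poly q n) < 2 ^ n"
    \<comment> \<open>The input has length \<open>poly q n\<close>, so the running time in terms of
      \<open>n\<close> is bounded by the composite polynomial.\<close>
    using poly_nat_less_power2[of N "pcompose p q"] by (auto simp: poly_pcompose)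
  define T where "T = poly p (poly q n)"
  define B :: "str set" where "B = {w \<in> A. length w \<le> N}"
  define x where "x = replicate (poly q n) True"
  define count :: "str set \<Rightarrow> nat" where "count X = card {w \<in> X. length w \<le> n}" for X
  have count: "count (insert w B) \<noteq> count B" if "length w = n" for w
  proof -
    have "{y \<in> insert w B. length y \<le> n} = insert w {y \<in> B. length y \<le> n}"
      using that by auto
    moreover have "w \<notin> B" using that n by (auto simp: B_def)
    moreover have "finite {y \<in> B. length y \<le> n}"
      by (rule finite_subset[OF _ finite_strings_upto[of n]]) auto
    ultimately show ?thesis by (simp add: count_def)
  qed
  obtain A' where A': "B \<subseteq> A'" "\<forall>w\<in>A' - B. length w = n"
      "\<forall>D. agree_upto T A' D \<longrightarrow> \<not> computes_within M D x T (bin (count A'))"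
    using exists_miscounted[where count = count, OF assms n(2) count] unfolding T_def by blast
  \<comment> \<open>The summands protect the count up to length \<open>n\<close>, the run of
    \<open>M\<close>, and the gap, in this order.\<close>
  let ?N' = "n + T + poly q (poly q n)"
  show "\<exists>A' N'. N \<le> N' \<and> agree_upto N A A' \<and>
      (\<forall>D. agree_upto N' A' D \<longrightarrow> miscounts_below_gap M p q D)"
  proof (intro exI[of _ A'] exI[of _ ?N'] conjI allI impI)
    show "N \<le> ?N'" using n by simp
    show "agree_upto N A A'"
      unfolding agree_upto_def
    proof (intro allI impI)
      fix w :: str assume w: "length w \<le> N"
      then have "w \<in> A \<longleftrightarrow> w \<in> B" by (simp add: B_def)
      moreover have "w \<notin> A' - B" using bspec[OF A'(2), of w] w n(1) by auto
      ultimately show "w \<in> A \<longleftrightarrow> w \<in> A'" using A'(1) by blast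
    qed
    fix D assume D: "agree_upto ?N' A' D"
    then have "count D = count A'"
      unfolding count_def agree_upto_def by (intro arg_cong[of _ _ card]) auto
    moreover have "agree_upto T A' D" using D by (simp add: agree_upto_def)
    ultimately have "\<not> computes_within M D x T (bin (count D))"
      using A'(3) by simp
    moreover have "length w \<le> n" if "w \<in> A'" for w
      using that bspec[OF A'(2), of w] n(1) by (cases "w \<in> B") (simp_all add: B_def)
    then have "\<forall>w\<in>D. length w \<le> n \<or> poly q (poly q n) < length w"
      using D unfolding agree_upto_def by (meson not_le trans_le_add2)
    ultimately show "miscounts_below_gap M p q D"
      unfolding miscounts_below_gap_def T_def x_def count_def by blast
  qed
qed

section \<open>From miscounting below a gap to non-scalability\<close>

lemma not_scalable_if_miscounts:
  assumes "\<And>M p q. wf_otm M \<Longrightarrow> miscounts_below_gap M p q D"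
  shows "\<not> scalable D D"
proof
  assume "scalable D D"
  then obtain \<phi> where \<phi>: "bij \<phi>" "\<phi> \<in> FP D" "inv \<phi> \<in> FP D"
      "(\<lambda>x. bin (rank_fun (\<phi> ` D) x)) \<in> FP D"
    unfolding scalable_def P_isomorphism_def rankable_def by blast
  have FP_length: "\<exists>p :: nat poly. \<forall>x. length (f x) \<le> poly p (length x)" if "f \<in> FP D" for f
    using that computes_within_length_le unfolding mem_FP_on_iff by (meson UNIV_I)
  obtain p1 p2 :: "nat poly" where p1: "\<And>x. length (\<phi> x) \<le> poly p1 (length x)"
    and p2: "\<And>y. length (inv \<phi> y) \<le> poly p2 (length y)"
    using FP_length[OF \<phi>(2)] FP_length[OF \<phi>(3)] by blast
  obtain M p where M: "wf_otm M"
      "\<And>x. computes_within M D x (poly p (length x)) (bin (rank_fun (\<phi> ` D) x))"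
    using \<phi>(4) unfolding mem_FP_on_iff by blast
  \<comment> \<open>One monotone bound serves both \<phi> and its inverse.\<close>
  define q where "q = p1 + p2"
  obtain n where gap: "\<And>x. x \<in> D \<Longrightarrow> length x \<le> n \<or> poly q (poly q n) < length x"
    and wrong: "\<not> computes_within M D (replicate (poly q n) True) (poly p (poly q n))
         (bin (card {x \<in> D. length x \<le> n}))"
    using assms[OF M(1), of p q] unfolding miscounts_below_gap_def by blast
  \<comment> \<open>The cut at length \<open>n\<close> in \<open>D\<close> becomes the cut at
    \<open>poly q n\<close> in the image: a preimage of a string of length at most
    \<open>poly q n\<close> has length at most \<open>poly q (poly q n)\<close>, and the gap pushes
    this down to \<open>n\<close>.\<close>
  have "length (\<phi> x) \<le> poly q n \<longleftrightarrow> length x \<le> n" if "x \<in> D" for x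
  proof
    assume "length x \<le> n"
    then show "length (\<phi> x) \<le> poly q n"
      using p1[of x] poly_nat_mono[of "length x" n p1] by (simp add: q_def)
  next
    assume "length (\<phi> x) \<le> poly q n"
    then have "length x \<le> poly q (poly q n)"
      using p2[of "\<phi> x"] poly_nat_mono[of "length (\<phi> x)" "poly q n" p2] bij_is_inj[OF \<phi>(1)]
      by (simp add: q_def)
    then show "length x \<le> n" using gap[OF that] by simp
  qed
  then have "{y \<in> \<phi> ` D. y \<le> replicate (poly q n) True} = \<phi> ` {x \<in> D. length x \<le> n}"
    by (auto simp: le_replicate_True_iff)
  then have "rank_fun (\<phi> ` D) (replicate (poly q n) True) = card {x \<in> D. length x \<le> n}"
    unfolding rank_fun_def using \<phi>(1)
    by (simp add: card_image bij_is_inj inj_on_subset[OF _ subset_UNIV])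
  then show False using M(2)[of "replicate (poly q n) True"] wrong by simp
qed

section \<open>Enumerating machines\<close>

instance sym :: countable by countable_datatype

instance dir :: countable by countable_datatype

lemma countable_nat_poly: "countable (UNIV :: nat poly set)"
proof (rule countableI')
  show "inj (\<lambda>p :: nat poly. to_nat (coeffs p))"
    by (auto intro!: injI simp: coeffs_eq_iff)
qed

text \<open>The graph of a finite transition function is a finite subset of a countable type, and
  there are only countably many of those.\<close>

lemma countable_wf_otm: "countable {M. wf_otm M}"
proof -
  define code where "code M = ((work_tapes M, start_state M, query_state M, yes_state M, no_state M,
    accept_state M), Map.graph (delta M))" for M :: otm
  have "inj code"
  proof (rule injI)
    fix M M' :: otm assume "code M = code M'"
    moreover from this have "delta M x = Some y \<longleftrightarrow> delta M' x = Some y" for x y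
      by (cases x; cases y) (auto simp: code_def graph_def set_eq_iff)
    then have "delta M = delta M'" by (metis ext not_Some_eq)
    ultimately show "M = M'" by (auto simp: code_def)
  qed
  then have "inj_on code {M. wf_otm M}" by (rule inj_on_subset) simp
  moreover have "code ` {M. wf_otm M} \<subseteq> UNIV \<times> {G. finite G}"
    by (auto simp: code_def wf_otm_def)
  then have "countable (code ` {M. wf_otm M})"
    by (rule countable_subset) (intro countable_SIGMA countableI_type countable_Collect_finite)
  ultimately show ?thesis by (rule countable_image_inj_on[rotated])
qed

section \<open>Every set is in polynomial time relative to itself\<close>

text \<open>The machine copies its input to the query tape bit by bit and then queries it. States 2
  and 3 have no transitions, so it halts on the answer.\<close>

definition query_input :: otm where
  "query_input = \<lparr>work_tapes = 0, start_state = 0, query_state = 1, yes_state = 2, no_state = 3,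
     accept_state = 2,
     delta = [(0, [Bit False, Blank, Blank]) \<mapsto>
                (0, [(Bit False, Go_Right), (Blank, Stay), (Bit False, Go_Right)]),
              (0, [Bit True, Blank, Blank]) \<mapsto>
                (0, [(Bit True, Go_Right), (Blank, Stay), (Bit True, Go_Right)]),
              (0, [Blank, Blank, Blank]) \<mapsto> (1, [(Blank, Stay), (Blank, Stay), (Blank, Stay)])]\<rparr>"

lemma wf_query_input: "wf_otm query_input"
  by (auto simp: wf_otm_def query_input_def ran_def)

definition prefix_tape :: "str \<Rightarrow> nat \<Rightarrow> tape" where
  "prefix_tape x t = (\<lambda>i. if i < t then Bit (x ! i) else Blank, t)"

lemma conf_query_input_copy:
  "t \<le> length x \<Longrightarrow>
     conf query_input X x t = Some (0, [(fst (input_tape x), t), blank_tape, prefix_tape x t])"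
proof (induction t)
  case 0
  then show ?case
    by (simp add: init_config_def query_input_def input_tape_def prefix_tape_def blank_tape_def
        numeral_2_eq_2)
next
  case (Suc t)
  then show ?case
    by (cases "x ! t")
      (auto simp: step_def query_input_def input_tape_def prefix_tape_def blank_tape_def
        read_sym_def act_def fun_eq_iff)
qed

lemma tape_str_prefix_tape: "tape_str (prefix_tape x (length x)) = x"
proof -
  have "(LEAST i. (if i < length x then Bit (x ! i) else Blank) \<notin> range Bit) = length x"
    by (rule Least_equality) (auto split: if_splits intro: ccontr)
  then show ?thesis
    by (auto simp: tape_str_def prefix_tape_def intro!: nth_equalityI)
qed

lemma mem_PTIME_self: "D \<in> PTIME D"
proof -
  \<comment> \<open>The two steps beyond copying are the entry into the query state and the query
    itself.\<close>
  have "\<exists>t\<le>poly [:2, 1:] (length x). \<exists>q ts. halts_in query_input D x t (q, ts) \<and>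
      (q = accept_state query_input \<longleftrightarrow> x \<in> D)" for x
  proof -
    let ?ts = "[(fst (input_tape x), length x), blank_tape, prefix_tape x (length x)]"
    have "step query_input D (0, ?ts) = Some (1, ?ts)"
      by (auto simp: step_def query_input_def input_tape_def prefix_tape_def blank_tape_def
        read_sym_def act_def fun_eq_iff)
    moreover have "step query_input D (1, ?ts) =
        Some (if x \<in> D then 2 else 3, ?ts[2 := blank_tape])"
      by (simp add: step_def query_input_def tape_str_prefix_tape)
    ultimately have "conf query_input D x (length x + 2) =
        Some (if x \<in> D then 2 else 3, ?ts[2 := blank_tape])"
      using conf_query_input_copy[of "length x" x D] by simp
    moreover have "step query_input D (if x \<in> D then 2 else 3, ts) = None" for ts
      by (simp add: step_def query_input_def)
    ultimately show ?thesis
      unfolding halts_in_iff_conf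
      by (intro exI[of _ "length x + 2"]) (auto simp: query_input_def)
  qed
  then show ?thesis
    unfolding PTIME_def using wf_query_input by blast
qed

theorem theorem5p4:
  "\<exists>D :: str set. D \<in> PTIME D \<and> \<not> scalable D D \<and>
     (\<lambda>x. bin (census D x)) \<notin> FP_on unary D"
proof -
  \<comment> \<open>One requirement for each machine and time bound against the census, and one for
    each machine, time bound and length bound against ranking; both index sets are
    countable.\<close>
  define \<P> where "\<P> =
    (\<lambda>(M, p) D. \<exists>x\<in>unary. \<not> computes_within M D x (poly p (length x)) (bin (census D x)))
      ` ({M. wf_otm M} \<times> UNIV) \<union>
    (\<lambda>(M, p, q). miscounts_below_gap M p q) ` ({M. wf_otm M} \<times> UNIV \<times> UNIV)"
  have "countable \<P>"
    unfolding \<P>_def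
    by (intro countable_Un countable_image countable_SIGMA countable_wf_otm)
      (auto simp flip: UNIV_Times_UNIV intro: countable_nat_poly)
  moreover have "forceable P" if "P \<in> \<P>" for P
    using that forceable_census forceable_miscounts_below_gap by (auto simp: \<P>_def)
  ultimately obtain D where D: "\<forall>P\<in>\<P>. P D" using exists_generic by blast
  have "miscounts_below_gap M p q D" if "wf_otm M" for M p q
    using bspec[OF D, of "miscounts_below_gap M p q"] that by (force simp: \<P>_def)
  moreover have "\<exists>x\<in>unary. \<not> computes_within M D x (poly p (length x)) (bin (census D x))"
    if "wf_otm M" for M p
    using bspec[OF D, of "\<lambda>D. \<exists>x\<in>unary. \<not> computes_within M D x (poly p (length x))
      (bin (census D x))"] that by (force simp: \<P>_def)
  ultimately show ?thesis
    using mem_PTIME_self not_scalable_if_miscounts unfolding mem_FP_on_iff by blast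
qed

end
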